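(* Let $k\ge 2$, $r\ge 1$ and $\alpha$ be integers with $0\le\alpha\le rk-1$. Let $m$ be the integer with $1\le m\le k$ and $(m-1)r\le\alpha<mr$. Let $\mathcal{A}$ be a sequence of $rk$ terms which is made up of $n$ distinct negative integers and $p$ distinct positive integers, each repeated exactly $r$ times (so $n+p=k$ and $0$ is not a term of $\mathcal{A}$). (i) If $m\le n$ and $m\le p$, then $|\Sigma_{\alpha}(\mathcal{A})|\ge r\left(\frac{n(n+1)}{2}+\frac{p(p+1)}{2}\right)+1$. (ii) If $m\le n$ and $m>p$, then $|\Sigma_{\alpha}(\mathcal{A})|\ge r\left(\frac{n(n+1)}{2}+\frac{p(p+1)}{2}-\frac{(m-p)(m-p+1)}{2}\right)+(m-p)(mr-\alpha)+1$. (iii) If $m>n$ and $m\le p$, then $|\Sigma_{\alpha}(\mathcal{A})|\ge r\left(\frac{n(n+1)}{2}+\frac{p(p+1)}{2}-\frac{(m-n)(m-n+1)}{2}\right)+(m-n)(mr-\alpha)+1$. (iv) If $m>n$ and $m>p$, then $|\Sigma_{\alpha}(\mathcal{A})|\ge r\left(\frac{n(n+1)}{2}+\frac{p(p+1)}{2}-\frac{(m-n)(m-n+1)}{2}-\frac{(m-p)(m-p+1)}{2}\right)+(2m-n-p)(mr-\alpha)+1$. These lower bounds are optimal, i.e. for all integers $k\ge 2$, $r\ge 1$, $\alpha$ with $0\le\alpha\le rk-1$, and all nonnegative integers $n,p$ with $n+p=k$, there is a sequence $\mathcal{A}$ of $rk$ terms, made up of $n$ distinct negative integers and $p$ distinct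 positive integers each repeated exactly $r$ times, for which equality holds in the bound of the applicable case.
   Context: Sequences are finite and unordered (multisets): a sequence $\mathcal{A}$ made up of distinct integers $a_1,\dots,a_k$, each repeated exactly $r$ times, has $rk$ terms. A subsequence $\mathcal{A}'\subset\mathcal{A}$ takes each $a_i$ some number of times between $0$ and $r$; $|\mathcal{A}'|$ denotes its number of terms counted with multiplicity. For an integer $0\le\alpha\le rk$, $\Sigma_{\alpha}(\mathcal{A})=\left\{\sum_{a\in\mathcal{A}'}a : \mathcal{A}'\subset\mathcal{A},\ |\mathcal{A}'|\ge\alpha\right\}$, where sums are taken with multiplicity and the empty sum is $0$; it is a set of integers and $|\Sigma_\alpha(\mathcal{A})|$ is its cardinality. *)

theory Defs
  imports Complex_Main "HOL-Library.Multiset"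
begin

definition repeated_sequence :: "nat \<Rightarrow> nat \<Rightarrow> nat \<Rightarrow> int multiset \<Rightarrow> bool" where
  "repeated_sequence r n p A \<longleftrightarrow>
     (\<forall>a \<in># A. count A a = r) \<and>
     0 \<notin># A \<and>
     card {a \<in> set_mset A. a < 0} = n \<and>
     card {a \<in> set_mset A. a > 0} = p"

definition subsequence_sums :: "nat \<Rightarrow> int multiset \<Rightarrow> int set" where
  "subsequence_sums \<alpha> A = {\<Sum>\<^sub># B | B. B \<subseteq># A \<and> \<alpha> \<le> size B}"

end

theory Submission
  imports Defs
begin

text \<open>
Put \<open>\<beta> = r k - \<alpha>\<close>. A subsequence with at least \<open>\<alpha>\<close> terms omits at most \<open>\<beta>\<close> of the \<open>r k\<close> terms, so
after padding the sequence with \<open>\<beta>\<close> zeros it becomes a subsequence with exactly \<open>r k\<close> terms, the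
zeros standing for omitted terms. All four bounds are thus instances of one statement about the
sums of the submultisets of a prescribed size \<open>N\<close> of a finite multiset \<open>M\<close>.

For such a submultiset \<open>B\<close> and \<open>t \<in> M\<close> let \<open>C\<^sub>t(B)\<close> be the number of terms of \<open>B\<close> that are at
least \<open>t\<close>, and let the weight of \<open>B\<close> be the sum of the \<open>C\<^sub>t(B)\<close>. Replacing a term of \<open>B\<close> by the next
larger value of \<open>M\<close> raises the weight by exactly one and strictly raises the sum. When no such
replacement is possible, \<open>B\<close> is packed to the right, that is,
\<open>C\<^sub>t(B) = min N (C\<^sub>t(M))\<close> for all \<open>t\<close>. Climbing from a \<open>B\<close> of smallest weight therefore produces at least
as many new sums as the difference between the largest and the smallest weight. The complement of a packed
submultiset of size \<open>|M| - N\<close> is a good starting point, and the difference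
becomes the sum over \<open>t\<close> of \<open>min {N, |M| - N, C\<^sub>t(M), |M| - C\<^sub>t(M)}\<close>
(\<open>card_sums_of_fixed_size_gt\<close>).

For the padded sequence, a positive \<open>t\<close> with \<open>j\<close> positive values at or above it contributes
\<open>min (r j) \<beta>\<close>, and a nonpositive \<open>t\<close> with \<open>i\<close> negative values below it contributes \<open>min (r i) \<beta>\<close>. Hence
\[ |\Sigma_\alpha| \ge 1 + \sum_{i=1}^{n} \min(ri,\beta) + \sum_{j=1}^{p} \min(rj,\beta) \]
(\<open>card_subsequence_sums_gt\<close>). Since \<open>\<beta>\<close> lies between \<open>r (k - m)\<close> and \<open>r (k - m + 1)\<close>, the minimum in the
second sum changes from \<open>r j\<close> to \<open>\<beta>\<close> at \<open>j = k - m\<close>, which is smaller than \<open>p\<close> precisely when \<open>m > n\<close>;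
symmetrically for the first sum. Evaluating the two sums gives the four cases.

For the values \<open>-n, \<dots>, -1, 1, \<dots>, p\<close> all sums lie in an interval of integers with exactly that many
elements (\<open>card_subsequence_sums_interval_sequence_le\<close>), so the bound is attained.
\<close>

section \<open>Climbing through submultisets of fixed size\<close>

text \<open>
Every step of the climb gains only one unit of \<open>w\<close> but strictly increases \<open>s\<close>, so each of the levels
\<open>w x, \<dots>, U\<close> that are visited supplies a new value of \<open>s\<close>.
\<close>

lemma card_image_gt_by_climbing:
  fixes w :: "'a \<Rightarrow> nat" and s :: "'a \<Rightarrow> 'b::linorder"
  assumes "finite S" and "x \<in> S"
    and step: "\<And>x. x \<in> S \<Longrightarrow> w x < U \<Longrightarrow> \<exists>y\<in>S. w y = Suc (w x) \<and> s x < s y"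
  shows "U < card (s ` S) + w x"
proof -
  \<comment> \<open>Restricting to values from \<open>s x\<close> on makes the value \<open>s x\<close> new relative to those found from \<open>y\<close>.\<close>
  have "U < card (s ` S \<inter> {s x..}) + w x"
    using \<open>x \<in> S\<close>
  proof (induction "U - w x" arbitrary: x)
    case 0
    have "card (s ` S \<inter> {s x..}) > 0"
      using 0 \<open>finite S\<close> by (auto simp: card_gt_0_iff)
    then show ?case using 0 by linarith
  next
    case (Suc d)
    then obtain y where y: "y \<in> S" "w y = Suc (w x)" "s x < s y"
      using step[of x] by force
    have "U < card (s ` S \<inter> {s y..}) + w y"
      using Suc y by (intro Suc.hyps(1)) auto
    moreover have "insert (s x) (s ` S \<inter> {s y..}) \<subseteq> s ` S \<inter> {s x..}"
      using y Suc.prems by auto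
    then have "card (insert (s x) (s ` S \<inter> {s y..})) \<le> card (s ` S \<inter> {s x..})"
      using \<open>finite S\<close> by (intro card_mono) auto
    moreover have "card (insert (s x) (s ` S \<inter> {s y..})) = Suc (card (s ` S \<inter> {s y..}))"
      using y \<open>finite S\<close> by (subst card_insert_disjoint) auto
    ultimately show ?case using y(2) by linarith
  qed
  moreover have "card (s ` S \<inter> {s x..}) \<le> card (s ` S)"
    using \<open>finite S\<close> by (intro card_mono) auto
  ultimately show ?thesis by linarith
qed

definition count_from :: "'a::linorder \<Rightarrow> 'a multiset \<Rightarrow> nat" where
  "count_from t B = size {#b \<in># B. t \<le> b#}"

lemma count_from_mono: "B \<subseteq># M \<Longrightarrow> count_from t B \<le> count_from t M"
  by (simp add: count_from_def multiset_filter_mono size_mset_mono)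

lemma count_from_le_size: "count_from t B \<le> size B"
  by (simp add: count_from_def size_mset_mono)

lemma count_from_diff:
  "B \<subseteq># M \<Longrightarrow> count_from t (M - B) = count_from t M - count_from t B"
  by (simp add: count_from_def multiset_filter_mono size_Diff_submset)

lemma count_from_union [simp]: "count_from t (A + B) = count_from t A + count_from t B"
  by (simp add: count_from_def)

lemma count_from_replicate [simp]:
  "count_from t (replicate_mset n x) = (if t \<le> x then n else 0)"
  by (induction n) (auto simp: count_from_def)

text \<open>
The sum of the ranks of the terms of \<open>B\<close> with respect to \<open>D\<close>: each term is counted once for every
threshold in \<open>D\<close> that it reaches.
\<close>

definition weight :: "'a::linorder set \<Rightarrow> 'a multiset \<Rightarrow> nat" where
  "weight D B = (\<Sum>t\<in>D. count_from t B)"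

text \<open>
If \<open>B\<close> contains \<open>x\<close> and has room for a larger \<open>y\<close>, then some term of \<open>B\<close> can move to the very next value of
\<open>M\<close>: the largest value of \<open>B\<close> below \<open>y\<close> has a successor in \<open>M\<close> which is either \<open>y\<close> itself or entirely
unused by \<open>B\<close>.
\<close>

lemma exists_adjacent_exchange:
  fixes M :: "'a::linorder multiset"
  assumes "B \<subseteq># M" and "x \<in># B" and "count B y < count M y" and "x < y"
  obtains a b where "a \<in># B" and "count B b < count M b" and "a < b"
    and "\<And>d. d \<in># M \<Longrightarrow> a < d \<Longrightarrow> b \<le> d"
proof -
  define a where "a = Max {d \<in> set_mset B. d < y}"
  have a: "a \<in> {d \<in> set_mset B. d < y}"
    unfolding a_def using assms by (intro Max_in) auto
  have a_max: "d \<le> a" if "d \<in># B" "d < y" for d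
    unfolding a_def using that by (intro Max_ge) auto
  have "y \<in># M" using assms(3) by (metis gr_implies_not0 count_eq_zero_iff)
  define b where "b = Min {d \<in> set_mset M. a < d}"
  have b: "b \<in> {d \<in> set_mset M. a < d}"
    unfolding b_def using a \<open>y \<in># M\<close> by (intro Min_in) auto
  have b_min: "b \<le> d" if "d \<in># M" "a < d" for d
    unfolding b_def using that by (intro Min_le) auto
  have "b \<le> y" using b_min a \<open>y \<in># M\<close> by auto
  have "count B b < count M b"
  proof (cases "b = y")
    case False
    then have "b \<notin># B" using a_max[of b] \<open>b \<le> y\<close> b by force
    then have "count B b = 0" by (simp add: not_in_iff)
    moreover have "count M b > 0" using b by simp
    ultimately show ?thesis by simp
  qed (use assms in simp)
  then show thesis using that a b b_min by blast
qed

text \<open>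
If the weight is below its upper bound, then some threshold \<open>t\<close> has both a term of \<open>B\<close> below it and room
at or above it, so an adjacent exchange exists. Exchanging \<open>a\<close> for its successor \<open>b\<close> crosses only the threshold \<open>b\<close>, which is why the weight grows by exactly one.
\<close>

lemma exists_heavier_submultiset:
  fixes M :: "'a::linordered_ab_group_add multiset"
  assumes "B \<subseteq># M"
    and "weight (set_mset M) B < (\<Sum>t\<in>set_mset M. min (size B) (count_from t M))"
  shows "\<exists>B'. B' \<subseteq># M \<and> size B' = size B \<and>
    weight (set_mset M) B' = Suc (weight (set_mset M) B) \<and> \<Sum>\<^sub># B < \<Sum>\<^sub># B'"
proof -
  obtain t where t: "t \<in># M" "count_from t B < min (size B) (count_from t M)"
    using assms(2) unfolding weight_def by (meson not_less sum_mono)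
  have "{#b \<in># B. t \<le> b#} \<noteq> B"
    using t by (auto simp: count_from_def)
  then obtain x where x: "x \<in># B" "x < t"
    by (metis filter_mset_True filter_mset_cong not_le)
  have "{#b \<in># B. t \<le> b#} \<noteq> {#b \<in># M. t \<le> b#}"
    using t by (auto simp: count_from_def)
  then obtain y where "count {#b \<in># B. t \<le> b#} y \<noteq> count {#b \<in># M. t \<le> b#} y"
    by (meson multiset_eqI)
  then have y: "t \<le> y" "count B y \<noteq> count M y"
    by (auto split: if_splits)
  then have "count B y < count M y"
    using mset_subset_eq_count[OF assms(1), of y] by simp
  have "x < y" using x(2) y(1) by (rule less_le_trans)
  obtain a b where ab: "a \<in># B" "count B b < count M b" "a < b"
    and next_b: "\<And>d. d \<in># M \<Longrightarrow> a < d \<Longrightarrow> b \<le> d"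
    by (rule exists_adjacent_exchange[OF assms(1) x(1) \<open>count B y < count M y\<close> \<open>x < y\<close>]) (rule that)
  obtain C where C: "B = add_mset a C"
    using ab(1) by (metis multi_member_split)
  have "b \<in># M" using ab(2) by (metis gr_implies_not0 count_eq_zero_iff)
  have "add_mset b C \<subseteq># M"
    unfolding subseteq_mset_def
  proof
    fix d
    have "count C d \<le> count B d" by (simp add: C)
    moreover have "count B d \<le> count M d" using assms(1) by (rule mset_subset_eq_count)
    ultimately show "count (add_mset b C) d \<le> count M d" using ab(2) by auto
  qed
  moreover have "weight (set_mset M) (add_mset b C) = Suc (weight (set_mset M) B)"
  proof -
    have "count_from t (add_mset b C) = count_from t B + (if t = b then 1 else 0)"
      if "t \<in># M" for t
      using next_b[OF that] ab(3) by (auto simp: count_from_def C)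
    then have "weight (set_mset M) (add_mset b C)
        = (\<Sum>t\<in>set_mset M. count_from t B + (if t = b then 1 else 0))"
      unfolding weight_def by (intro sum.cong) auto
    then show ?thesis
      using \<open>b \<in># M\<close> by (simp add: sum.distrib weight_def)
  qed
  moreover have "\<Sum>\<^sub># B < \<Sum>\<^sub># (add_mset b C)"
    using ab(3) by (simp add: C)
  ultimately show ?thesis
    using C by (intro exI[of _ "add_mset b C"]) simp
qed

lemma finite_submultisets: "finite {B. B \<subseteq># M}"
proof (induction M)
  case (add x M)
  have "{B. B \<subseteq># add_mset x M} \<subseteq> {B. B \<subseteq># M} \<union> add_mset x ` {B. B \<subseteq># M}"
  proof
    fix B assume "B \<in> {B. B \<subseteq># add_mset x M}"
    then have B: "B \<subseteq># add_mset x M" by simp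
    show "B \<in> {B. B \<subseteq># M} \<union> add_mset x ` {B. B \<subseteq># M}"
    proof (cases "x \<in># B")
      case True
      then obtain C where "B = add_mset x C" by (metis multi_member_split)
      then show ?thesis using B by auto
    next
      case False
      then show ?thesis using B
        by (auto simp: subseteq_mset_def not_in_iff split: if_splits) (metis Suc_n_not_le_n le0 le_SucI)
    qed
  qed
  then show ?case using add finite_subset by auto
qed simp

lemma exists_submultiset_of_size: "N \<le> size M \<Longrightarrow> \<exists>B. B \<subseteq># M \<and> size B = N"
proof (induction M arbitrary: N)
  case (add x M)
  show ?case
  proof (cases N)
    case (Suc N')
    then have "N' \<le> size M" using add.prems by simp
    then obtain B where "B \<subseteq># M" "size B = N'" using add.IH by blast
    then show ?thesis using Suc by (intro exI[of _ "add_mset x B"]) simp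
  qed (auto intro: exI[of _ "{#}"])
qed simp

lemma exists_heavy_submultiset:
  fixes M :: "'a::linordered_ab_group_add multiset"
  assumes "N \<le> size M"
  shows "\<exists>B. B \<subseteq># M \<and> size B = N \<and>
    (\<Sum>t\<in>set_mset M. min N (count_from t M)) \<le> weight (set_mset M) B"
proof -
  let ?S = "{B. B \<subseteq># M \<and> size B = N}"
  have "finite ?S"
    by (rule finite_subset[OF _ finite_submultisets[of M]]) auto
  moreover have "?S \<noteq> {}" using exists_submultiset_of_size[OF assms] by auto
  ultimately have "Max (weight (set_mset M) ` ?S) \<in> weight (set_mset M) ` ?S"
    by (intro Max_in) auto
  then obtain B where B: "B \<in> ?S" "weight (set_mset M) B = Max (weight (set_mset M) ` ?S)"
    by auto
  have "\<not> weight (set_mset M) B < (\<Sum>t\<in>set_mset M. min N (count_from t M))"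
  proof
    assume "weight (set_mset M) B < (\<Sum>t\<in>set_mset M. min N (count_from t M))"
    then have "\<exists>B'. B' \<subseteq># M \<and> size B' = size B \<and>
        weight (set_mset M) B' = Suc (weight (set_mset M) B) \<and> \<Sum>\<^sub># B < \<Sum>\<^sub># B'"
      using B(1) by (intro exists_heavier_submultiset) simp_all
    then obtain B' where B': "B' \<in> ?S" "weight (set_mset M) B' = Suc (weight (set_mset M) B)"
      using B(1) by blast
    have "weight (set_mset M) B' \<le> weight (set_mset M) B"
      unfolding B(2) using B'(1) \<open>finite ?S\<close> by (intro Max_ge) auto
    then show False using B'(2) by simp
  qed
  then show ?thesis using B(1) by auto
qed

text \<open>
Climbing starts at the complement of a heavy submultiset of the complementary size. The four-fold
minimum arises from \<open>min N c + min (s - N) c - c\<close>, where \<open>s\<close> is the size of \<open>M\<close> and \<open>c \<le> s\<close> is the number of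
terms from \<open>t\<close> on; it is symmetric under complementing \<open>B\<close> and under reversing the order.
\<close>

theorem card_sums_of_fixed_size_gt:
  fixes M :: "'a::linordered_ab_group_add multiset"
  assumes "N \<le> size M"
  shows "(\<Sum>t\<in>set_mset M. min (min N (size M - N)) (min (count_from t M) (size M - count_from t M)))
    < card (sum_mset ` {B. B \<subseteq># M \<and> size B = N})"
proof -
  let ?S = "{B. B \<subseteq># M \<and> size B = N}" and ?w = "weight (set_mset M)"
  let ?U = "\<Sum>t\<in>set_mset M. min N (count_from t M)"
  have fin: "finite ?S"
    by (rule finite_subset[OF _ finite_submultisets[of M]]) auto
  obtain C where C: "C \<subseteq># M" "size C = size M - N"
    "(\<Sum>t\<in>set_mset M. min (size M - N) (count_from t M)) \<le> ?w C"
    using exists_heavy_submultiset[of "size M - N" M] by auto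
  have light: "?w (M - C) + ?w C = (\<Sum>t\<in>set_mset M. count_from t M)"
    using C(1) count_from_mono[OF C(1)]
    by (simp add: weight_def count_from_diff flip: sum.distrib)
  have "M - C \<in> ?S"
    using C assms by (simp add: size_Diff_submset)
  then have climb: "?U < card (sum_mset ` ?S) + ?w (M - C)"
  proof (rule card_image_gt_by_climbing[OF fin])
    fix B assume "B \<in> ?S" "?w B < ?U"
    then have "\<exists>B'. B' \<subseteq># M \<and> size B' = size B \<and> ?w B' = Suc (?w B) \<and> \<Sum>\<^sub># B < \<Sum>\<^sub># B'"
      by (intro exists_heavier_submultiset) simp_all
    then show "\<exists>B'\<in>?S. ?w B' = Suc (?w B) \<and> \<Sum>\<^sub># B < \<Sum>\<^sub># B'"
      using \<open>B \<in> ?S\<close> by blast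
  qed
  have "(\<Sum>t\<in>set_mset M. min (min N (size M - N)) (min (count_from t M) (size M - count_from t M))
      + count_from t M) = (\<Sum>t\<in>set_mset M. min N (count_from t M) + min (size M - N) (count_from t M))"
  proof (intro sum.cong refl)
    fix t
    show "min (min N (size M - N)) (min (count_from t M) (size M - count_from t M)) + count_from t M
        = min N (count_from t M) + min (size M - N) (count_from t M)"
      using assms count_from_le_size[of t M] by linarith
  qed
  then show ?thesis
    using climb C(3) light by (simp add: sum.distrib)
qed

section \<open>Sequences with constant multiplicity\<close>

lemma sum_over_upper_ranks:
  fixes S :: "'a::linorder set" and f :: "nat \<Rightarrow> nat"
  assumes "finite S"
  shows "(\<Sum>t\<in>S. f (card {a\<in>S. t \<le> a})) = (\<Sum>j=1..card S. f j)"
  using assms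
proof (induction rule: finite_linorder_min_induct)
  case (insert b S)
  have "b \<notin> S" using insert by auto
  have "{a \<in> insert b S. b \<le> a} = insert b S" using insert by force
  moreover have "(\<Sum>t\<in>S. f (card {a \<in> insert b S. t \<le> a})) = (\<Sum>t\<in>S. f (card {a \<in> S. t \<le> a}))"
  proof (rule sum.cong[OF refl])
    fix t assume "t \<in> S"
    then have "{a \<in> insert b S. t \<le> a} = {a \<in> S. t \<le> a}" using insert by force
    then show "f (card {a \<in> insert b S. t \<le> a}) = f (card {a \<in> S. t \<le> a})" by simp
  qed
  ultimately show ?case using insert \<open>b \<notin> S\<close> by simp
qed simp

lemma sum_over_lower_ranks:
  fixes S :: "'a::linorder set" and f :: "nat \<Rightarrow> nat"
  assumes "finite S"
  shows "(\<Sum>t\<in>S. f (card {a\<in>S. a < t})) = (\<Sum>j<card S. f j)"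
  using assms
proof (induction rule: finite_linorder_max_induct)
  case (insert b S)
  have "b \<notin> S" using insert by auto
  have "{a \<in> insert b S. a < b} = S" using insert by force
  moreover have "(\<Sum>t\<in>S. f (card {a \<in> insert b S. a < t})) = (\<Sum>t\<in>S. f (card {a \<in> S. a < t}))"
  proof (rule sum.cong[OF refl])
    fix t assume "t \<in> S"
    then have "{a \<in> insert b S. a < t} = {a \<in> S. a < t}" using insert by force
    then show "f (card {a \<in> insert b S. a < t}) = f (card {a \<in> S. a < t})" by simp
  qed
  ultimately show ?case using insert \<open>b \<notin> S\<close> by (simp add: add.commute)
qed simp

lemma size_filter_of_constant_multiplicity:
  assumes "\<forall>a\<in>#A. count A a = r"
  shows "size {#a \<in># A. P a#} = r * card {a \<in> set_mset A. P a}"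
proof -
  have "size {#a \<in># A. P a#} = (\<Sum>a\<in>{a \<in> set_mset A. P a}. count {#a \<in># A. P a#} a)"
    by (simp add: size_multiset_overloaded_eq)
  also have "\<dots> = (\<Sum>a\<in>{a \<in> set_mset A. P a}. r)"
    using assms by (intro sum.cong) auto
  finally show ?thesis by simp
qed

text \<open>
At most \<open>size A - \<alpha>\<close> terms of \<open>B\<close> come from the padding, so at least \<open>\<alpha>\<close> come from \<open>A\<close>, and deleting the
padding zeros leaves the sum unchanged.
\<close>

lemma fixed_size_sums_of_padding_subset:
  assumes "\<alpha> \<le> size A"
  shows "sum_mset ` {B. B \<subseteq># A + replicate_mset (size A - \<alpha>) 0 \<and> size B = size A}
    \<subseteq> subsequence_sums \<alpha> A"
proof
  fix s assume "s \<in> sum_mset ` {B. B \<subseteq># A + replicate_mset (size A - \<alpha>) 0 \<and> size B = size A}"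
  then obtain B where B: "B \<subseteq># A + replicate_mset (size A - \<alpha>) 0" "size B = size A" "s = \<Sum>\<^sub># B"
    by auto
  define C where "C = B - replicate_mset (size A - \<alpha>) 0"
  let ?Z = "B \<inter># replicate_mset (size A - \<alpha>) 0"
  have "B = C + ?Z" by (simp add: C_def multiset_eq_iff)
  moreover have "\<Sum>\<^sub># ?Z = 0"
    by (rule sum_mset.neutral) (auto dest: in_replicate_mset[THEN iffD1])
  ultimately have "\<Sum>\<^sub># C = s" using B(3) by (metis add.right_neutral sum_mset.union)
  moreover have "C \<subseteq># A" using B(1) by (simp add: C_def subset_eq_diff_conv)
  moreover have "size B - (size A - \<alpha>) \<le> size C"
    unfolding C_def by (metis diff_size_le_size_Diff size_replicate_mset)
  ultimately show "s \<in> subsequence_sums \<alpha> A"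
    using B(2) assms by (auto simp: subsequence_sums_def intro!: exI[of _ C])
qed

text \<open>
The four cases in one formula. Padding with zeros adds the threshold \<open>0\<close>; it belongs with the negative
values, since a nonpositive threshold is measured by the number of terms strictly below it, none of which is
a padding zero.
\<close>

lemma card_subsequence_sums_gt:
  assumes A: "repeated_sequence r n p A" and "\<alpha> < size A"
  shows "(\<Sum>j=1..n. min (r * j) (size A - \<alpha>)) + (\<Sum>j=1..p. min (r * j) (size A - \<alpha>))
    < card (subsequence_sums \<alpha> A)"
proof -
  define \<beta> where "\<beta> = size A - \<alpha>"
  define M where "M = A + replicate_mset \<beta> 0"
  define P where "P = {a \<in> set_mset A. a > 0}"
  define Q where "Q = insert 0 {a \<in> set_mset A. a < 0}"
  have "\<beta> > 0" using assms(2) by (simp add: \<beta>_def)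
  have mult: "\<forall>a\<in>#A. count A a = r" and "0 \<notin># A" and cards: "card P = p" "card Q = Suc n"
    using A by (auto simp: repeated_sequence_def P_def Q_def)
  have D: "set_mset M = Q \<union> P" "Q \<inter> P = {}" "finite Q" "finite P"
    using \<open>\<beta> > 0\<close> \<open>0 \<notin># A\<close> by (auto simp: M_def P_def Q_def not_less_iff_gr_or_eq)
  have size_M: "size M = size A + \<beta>" by (simp add: M_def)
  let ?g = "\<lambda>t. min (min (size A) (size M - size A)) (min (count_from t M) (size M - count_from t M))"
  \<comment> \<open>For \<open>t \<in> P\<close> the terms from \<open>t\<close> on, and for \<open>t \<in> Q\<close> the terms below \<open>t\<close>, exclude the padding. There
    are at most \<open>size A\<close> of them, so the terms on the other side of \<open>t\<close> number at least \<open>\<beta>\<close>.\<close>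
  have upper: "?g t = min (r * card {a \<in> P. t \<le> a}) \<beta>" if "t \<in> P" for t
  proof -
    have from_A: "count_from t M = size {#a \<in># A. t \<le> a#}"
      using that by (simp add: M_def P_def) (simp add: count_from_def)
    also have "\<dots> = r * card {a \<in> set_mset A. t \<le> a}"
      by (rule size_filter_of_constant_multiplicity[OF mult])
    also have "{a \<in> set_mset A. t \<le> a} = {a \<in> P. t \<le> a}"
      using that by (auto simp: P_def)
    finally have c: "count_from t M = r * card {a \<in> P. t \<le> a}" .
    have "count_from t M \<le> size A"
      unfolding from_A by simp
    then show ?thesis using c[symmetric] size_M by simp
  qed
  have lower: "?g t = min (r * card {a \<in> Q. a < t}) \<beta>" if "t \<in> Q" for t
  proof -
    have "t \<le> 0" using that by (auto simp: Q_def)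
    have "count_from t M + size {#a \<in># A. a < t#} = size M"
      using \<open>t \<le> 0\<close> arg_cong[OF multiset_partition[of A "\<lambda>a. t \<le> a"], of size]
      by (simp add: M_def not_le) (simp add: count_from_def)
    moreover have "size {#a \<in># A. a < t#} = r * card {a \<in> Q. a < t}"
    proof -
      have "{a \<in> set_mset A. a < t} = {a \<in> Q. a < t}"
        using \<open>t \<le> 0\<close> by (auto simp: Q_def)
      then show ?thesis by (simp only: size_filter_of_constant_multiplicity[OF mult])
    qed
    moreover have "size {#a \<in># A. a < t#} \<le> size A" by simp
    ultimately show ?thesis using size_M by linarith
  qed
  have "(\<Sum>t\<in>set_mset M. ?g t) = (\<Sum>t\<in>Q. ?g t) + (\<Sum>t\<in>P. ?g t)"
    using D by (simp add: sum.union_disjoint)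
  also have "(\<Sum>t\<in>Q. ?g t) = (\<Sum>t\<in>Q. min (r * card {a \<in> Q. a < t}) \<beta>)"
    using lower by (intro sum.cong) auto
  also have "\<dots> = (\<Sum>j<Suc n. min (r * j) \<beta>)"
    using sum_over_lower_ranks[OF \<open>finite Q\<close>, of "\<lambda>j. min (r * j) \<beta>"] cards by simp
  also have "\<dots> = (\<Sum>j=1..n. min (r * j) \<beta>)"
    by (simp add: sum.lessThan_Suc_shift sum.atLeast1_atMost_eq del: sum.lessThan_Suc)
  also have "(\<Sum>t\<in>P. ?g t) = (\<Sum>t\<in>P. min (r * card {a \<in> P. t \<le> a}) \<beta>)"
    using upper by (intro sum.cong) auto
  also have "\<dots> = (\<Sum>j=1..p. min (r * j) \<beta>)"
    using sum_over_upper_ranks[OF \<open>finite P\<close>, of "\<lambda>j. min (r * j) \<beta>"] cards by simp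
  finally have "(\<Sum>j=1..n. min (r * j) \<beta>) + (\<Sum>j=1..p. min (r * j) \<beta>)
      < card (sum_mset ` {B. B \<subseteq># M \<and> size B = size A})"
    using card_sums_of_fixed_size_gt[of "size A" M] size_M by simp
  also have "\<dots> \<le> card (subsequence_sums \<alpha> A)"
  proof (rule card_mono)
    have "subsequence_sums \<alpha> A \<subseteq> sum_mset ` {B. B \<subseteq># A}"
      by (auto simp: subsequence_sums_def)
    then show "finite (subsequence_sums \<alpha> A)"
      using finite_submultisets finite_subset by blast
    show "sum_mset ` {B. B \<subseteq># M \<and> size B = size A} \<subseteq> subsequence_sums \<alpha> A"
      using fixed_size_sums_of_padding_subset[of \<alpha> A] assms(2) by (simp add: M_def \<beta>_def)
  qed
  finally show ?thesis by (simp add: \<beta>_def)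
qed

section \<open>The extremal sequence\<close>

definition interval_sequence :: "nat \<Rightarrow> nat \<Rightarrow> nat \<Rightarrow> int multiset" where
  "interval_sequence r n p = repeat_mset r (mset_set ({- int n..int p} - {0}))"

lemma count_interval_sequence:
  "count (interval_sequence r n p) a = (if a \<in> {- int n..int p} - {0} then r else 0)"
  by (simp add: interval_sequence_def)

lemma set_interval_sequence:
  "r > 0 \<Longrightarrow> set_mset (interval_sequence r n p) = {- int n..int p} - {0}"
  by (auto simp: count_interval_sequence simp flip: count_greater_zero_iff split: if_splits)

lemma size_interval_sequence: "size (interval_sequence r n p) = r * (n + p)"
  by (simp add: interval_sequence_def card_Diff_singleton nat_diff_distrib nat_add_distrib)

lemma repeated_sequence_interval_sequence:
  assumes "r > 0"
  shows "repeated_sequence r n p (interval_sequence r n p)"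
proof -
  have "{a \<in> {- int n..int p} - {0}. a < 0} = {- int n..<0}"
    "{a \<in> {- int n..int p} - {0}. 0 < a} = {0<..int p}" by auto
  then show ?thesis
    using assms by (simp add: repeated_sequence_def set_interval_sequence count_interval_sequence)
qed

text \<open>
A positive integer is the number of positive thresholds that it reaches, and a negative one is minus
the number of negative thresholds that it reaches from above.
\<close>

lemma sum_mset_by_thresholds:
  assumes "set_mset B \<subseteq> {- int n..int p}"
  shows "\<Sum>\<^sub># B = (\<Sum>j=1..p. int (size {#b \<in># B. int j \<le> b#}))
    - (\<Sum>j=1..n. int (size {#b \<in># B. b \<le> - int j#}))"
  using assms
proof (induction B)
  case (add b B)
  have "b = (\<Sum>j=1..p. of_bool (int j \<le> b)) - (\<Sum>j=1..n. of_bool (b \<le> - int j))"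
  proof -
    have "{j \<in> {1..p}. int j \<le> b} = {1..nat b}" "{j \<in> {1..n}. b \<le> - int j} = {1..nat (- b)}"
      using add.prems by auto
    then show ?thesis by (simp add: sum_of_bool_eq Int_def)
  qed
  moreover have "(\<Sum>j=1..p. int (size {#c \<in># add_mset b B. int j \<le> c#}))
      = (\<Sum>j=1..p. of_bool (int j \<le> b)) + (\<Sum>j=1..p. int (size {#c \<in># B. int j \<le> c#}))"
    by (subst sum.distrib[symmetric], rule sum.cong) auto
  moreover have "(\<Sum>j=1..n. int (size {#c \<in># add_mset b B. c \<le> - int j#}))
      = (\<Sum>j=1..n. of_bool (b \<le> - int j)) + (\<Sum>j=1..n. int (size {#c \<in># B. c \<le> - int j#}))"
    by (subst sum.distrib[symmetric], rule sum.cong) auto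
  ultimately show ?case using add by simp
qed simp

lemma size_filter_loss:
  assumes "B \<subseteq># A"
  shows "size {#b \<in># B. P b#} \<le> size {#a \<in># A. P a#}"
    and "size {#a \<in># A. P a#} \<le> size {#b \<in># B. P b#} + (size A - size B)"
proof -
  obtain C where "A = B + C" using assms by (metis mset_subset_eq_exists_conv)
  then show "size {#b \<in># B. P b#} \<le> size {#a \<in># A. P a#}"
    and "size {#a \<in># A. P a#} \<le> size {#b \<in># B. P b#} + (size A - size B)"
    by simp_all
qed

text \<open>
Omitting at most \<open>\<beta>\<close> terms lowers the number of terms beyond a threshold, which is \<open>r i\<close> for the whole sequence, by
at most \<open>min (r i) \<beta>\<close>. Summing over the thresholds confines the sums to an interval whose length is the
sum of these slacks.
\<close>

lemma card_subsequence_sums_interval_sequence_le: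
  fixes r n p \<alpha> :: nat
  assumes "r > 0"
  defines "\<beta> \<equiv> r * (n + p) - \<alpha>"
  shows "card (subsequence_sums \<alpha> (interval_sequence r n p))
    \<le> (\<Sum>j=1..n. min (r * j) \<beta>) + (\<Sum>j=1..p. min (r * j) \<beta>) + 1"
proof -
  let ?A = "interval_sequence r n p"
  let ?f = "\<lambda>j. int (r * j)" and ?g = "\<lambda>j. int (r * j) - int (min (r * j) \<beta>)"
  have mult: "\<forall>a\<in>#?A. count ?A a = r"
    using repeated_sequence_interval_sequence[OF assms(1)] by (simp add: repeated_sequence_def)
  have pos: "size {#a \<in># ?A. int j \<le> a#} = r * (p + 1 - j)" if "j \<in> {1..p}" for j
  proof -
    have "{a \<in> {- int n..int p} - {0}. int j \<le> a} = {int j..int p}" using that by auto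
    then show ?thesis
      using that size_filter_of_constant_multiplicity[OF mult, of "\<lambda>a. int j \<le> a"]
      by (simp add: set_interval_sequence[OF assms(1)]) linarith
  qed
  have neg: "size {#a \<in># ?A. a \<le> - int j#} = r * (n + 1 - j)" if "j \<in> {1..n}" for j
  proof -
    have "{a \<in> {- int n..int p} - {0}. a \<le> - int j} = {- int n..- int j}" using that by auto
    then show ?thesis
      using that size_filter_of_constant_multiplicity[OF mult, of "\<lambda>a. a \<le> - int j"]
      by (simp add: set_interval_sequence[OF assms(1)]) linarith
  qed
  define L where "L = (\<Sum>j=1..p. ?g j) - (\<Sum>j=1..n. ?f j)"
  define H where "H = (\<Sum>j=1..p. ?f j) - (\<Sum>j=1..n. ?g j)"
  have "subsequence_sums \<alpha> ?A \<subseteq> {L..H}"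
  proof
    fix s assume "s \<in> subsequence_sums \<alpha> ?A"
    then obtain B where B: "B \<subseteq># ?A" "\<alpha> \<le> size B" "s = \<Sum>\<^sub># B"
      by (auto simp: subsequence_sums_def)
    have lost: "size ?A - size B \<le> \<beta>"
      using B(2) by (simp add: \<beta>_def size_interval_sequence)
    have range: "int (size {#b \<in># B. P b#}) \<in> {?g i..?f i}" if "size {#a \<in># ?A. P a#} = r * i" for P i
      using size_filter_loss[OF B(1), of P] lost that unfolding atLeastAtMost_iff by linarith
    have s: "s = (\<Sum>j=1..p. int (size {#b \<in># B. int j \<le> b#}))
        - (\<Sum>j=1..n. int (size {#b \<in># B. b \<le> - int j#}))"
      unfolding B(3)
      using mset_subset_eqD[OF B(1)] set_interval_sequence[OF assms(1), of n p]
      by (intro sum_mset_by_thresholds) auto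
    have p: "(\<Sum>j=1..p. ?g (p + 1 - j)) \<le> (\<Sum>j=1..p. int (size {#b \<in># B. int j \<le> b#}))"
      "(\<Sum>j=1..p. int (size {#b \<in># B. int j \<le> b#})) \<le> (\<Sum>j=1..p. ?f (p + 1 - j))"
      using range[OF pos] by (auto intro!: sum_mono)
    have n: "(\<Sum>j=1..n. ?g (n + 1 - j)) \<le> (\<Sum>j=1..n. int (size {#b \<in># B. b \<le> - int j#}))"
      "(\<Sum>j=1..n. int (size {#b \<in># B. b \<le> - int j#})) \<le> (\<Sum>j=1..n. ?f (n + 1 - j))"
      using range[OF neg] by (auto intro!: sum_mono)
    have rev: "(\<Sum>j=1..q. h (q + 1 - j)) = (\<Sum>j=1..q. h j)" for q and h :: "nat \<Rightarrow> int"
      using sum.atLeastAtMost_rev[of h 1 q] by simp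
    show "s \<in> {L..H}"
      using p n unfolding s L_def H_def rev[of ?f] rev[of ?g] by auto
  qed
  then have "card (subsequence_sums \<alpha> ?A) \<le> card {L..H}"
    by (intro card_mono) auto
  also have "card {L..H} = (\<Sum>j=1..n. min (r * j) \<beta>) + (\<Sum>j=1..p. min (r * j) \<beta>) + 1"
  proof -
    have "H - L = int ((\<Sum>j=1..n. min (r * j) \<beta>) + (\<Sum>j=1..p. min (r * j) \<beta>))"
      by (simp only: H_def L_def sum_subtractf of_nat_sum of_nat_add)
    then have "H - L + 1 = int ((\<Sum>j=1..n. min (r * j) \<beta>) + (\<Sum>j=1..p. min (r * j) \<beta>) + 1)"
      by linarith
    then show ?thesis by (metis card_atLeastAtMost_int add_diff_eq diff_add_eq nat_int)
  qed
  finally show ?thesis .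
qed

section \<open>Evaluation of the bound\<close>

lemma sum_truncated_progression:
  assumes "r * q \<le> \<beta>" and "\<beta> \<le> r * (q + 1)"
  shows "real (\<Sum>j=1..p. min (r * j) \<beta>) =
    (if p \<le> q then real r * (real p * (real p + 1) / 2)
     else real r * (real q * (real q + 1) / 2) + (real p - real q) * real \<beta>)"
proof (induction p)
  case (Suc p)
  show ?case
  proof (cases "Suc p \<le> q")
    case True
    then have "r * Suc p \<le> r * q" by (intro mult_le_mono2)
    then have "min (r * Suc p) \<beta> = r * Suc p" using assms(1) by linarith
    then show ?thesis using Suc True by (simp add: field_simps)
  next
    case False
    then have "r * (q + 1) \<le> r * Suc p" by (intro mult_le_mono2) simp
    then have "min (r * Suc p) \<beta> = \<beta>" using assms(2) by linarith
    then have "real (\<Sum>j=1..Suc p. min (r * j) \<beta>) = real (\<Sum>j=1..p. min (r * j) \<beta>) + real \<beta>"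
      by simp
    moreover have "real (\<Sum>j=1..p. min (r * j) \<beta>)
        = real r * (real q * (real q + 1) / 2) + (real p - real q) * real \<beta>"
      using Suc False by (cases "p = q") auto
    ultimately show ?thesis using False by (simp add: algebra_simps)
  qed
qed simp

text \<open>
With \<open>q = k - m\<close> the truncation starts after \<open>j = q\<close>, and \<open>p - q = m - n\<close>. Stated through \<open>m\<close> and \<open>n\<close>, the
truncated sum is the full triangular sum minus the losses \<open>r (q + i) - (r k - \<alpha>) = r i - (m r - \<alpha>)\<close>
for \<open>1 \<le> i \<le> m - n\<close>.
\<close>

lemma sum_truncated_progression_split:
  assumes "n + p = k" and "m \<le> k" and "(m - 1) * r \<le> \<alpha>" and "\<alpha> < m * r"
  shows "real (\<Sum>j=1..p. min (r * j) (r * k - \<alpha>)) =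
    (if m \<le> n then real r * (real p * (real p + 1) / 2)
     else real r * (real p * (real p + 1) / 2 - (real m - real n) * (real m - real n + 1) / 2)
       + (real m - real n) * (real m * real r - real \<alpha>))"
proof -
  define q where "q = k - m"
  have k: "k = q + m" using assms(2) by (simp add: q_def)
  have "m > 0" using assms(4) by (cases m) auto
  have \<alpha>: "\<alpha> \<le> r * k" using assms(4) by (simp add: k algebra_simps)
  have "r * q \<le> r * k - \<alpha>" using assms(4) by (simp add: k algebra_simps)
  moreover have "r * k - \<alpha> \<le> r * (q + 1)"
    using assms(3) \<open>m > 0\<close> by (cases m) (simp_all add: k algebra_simps)
  ultimately have sum: "real (\<Sum>j=1..p. min (r * j) (r * k - \<alpha>)) =
    (if p \<le> q then real r * (real p * (real p + 1) / 2)
     else real r * (real q * (real q + 1) / 2) + (real p - real q) * real (r * k - \<alpha>))"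
    by (rule sum_truncated_progression)
  have "p \<le> q \<longleftrightarrow> m \<le> n" using k assms(1) by auto
  moreover have "real p = real q + real m - real n"
    using k assms(1) by linarith
  moreover have "real (r * k - \<alpha>) = real r * (real q + real m) - real \<alpha>"
    using \<alpha> by (simp add: k of_nat_diff)
  ultimately show ?thesis
    unfolding sum by (simp only: split: if_splits) (auto simp: field_simps)
qed

theorem theorem7:
  fixes k r \<alpha> m n p :: nat
  assumes "k \<ge> 2" and "r \<ge> 1" and "\<alpha> \<le> r * k - 1"
    and "1 \<le> m" and "m \<le> k" and "(m - 1) * r \<le> \<alpha>" and "\<alpha> < m * r"
    and "n + p = k"
  shows
    "(\<forall>A. size A = r * k \<and> repeated_sequence r n p A \<longrightarrow>
        (m \<le> n \<and> m \<le> p \<longrightarrow>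
           real (card (subsequence_sums \<alpha> A)) \<ge>
             real r * (real n * (real n + 1) / 2 + real p * (real p + 1) / 2) + 1) \<and>
        (m \<le> n \<and> m > p \<longrightarrow>
           real (card (subsequence_sums \<alpha> A)) \<ge>
             real r * (real n * (real n + 1) / 2 + real p * (real p + 1) / 2
               - (real m - real p) * (real m - real p + 1) / 2)
             + (real m - real p) * (real m * real r - real \<alpha>) + 1) \<and>
        (m > n \<and> m \<le> p \<longrightarrow>
           real (card (subsequence_sums \<alpha> A)) \<ge>
             real r * (real n * (real n + 1) / 2 + real p * (real p + 1) / 2
               - (real m - real n) * (real m - real n + 1) / 2)
             + (real m - real n) * (real m * real r - real \<alpha>) + 1) \<and>
        (m > n \<and> m > p \<longrightarrow>
           real (card (subsequence_sums \<alpha> A)) \<ge>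
             real r * (real n * (real n + 1) / 2 + real p * (real p + 1) / 2
               - (real m - real n) * (real m - real n + 1) / 2
               - (real m - real p) * (real m - real p + 1) / 2)
             + (2 * real m - real n - real p) * (real m * real r - real \<alpha>) + 1)) \<and>
     (\<exists>A. size A = r * k \<and> repeated_sequence r n p A \<and>
        (m \<le> n \<and> m \<le> p \<longrightarrow>
           real (card (subsequence_sums \<alpha> A)) =
             real r * (real n * (real n + 1) / 2 + real p * (real p + 1) / 2) + 1) \<and>
        (m \<le> n \<and> m > p \<longrightarrow>
           real (card (subsequence_sums \<alpha> A)) =
             real r * (real n * (real n + 1) / 2 + real p * (real p + 1) / 2
               - (real m - real p) * (real m - real p + 1) / 2)
             + (real m - real p) * (real m * real r - real \<alpha>) + 1) \<and>
        (m > n \<and> m \<le> p \<longrightarrow>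
           real (card (subsequence_sums \<alpha> A)) =
             real r * (real n * (real n + 1) / 2 + real p * (real p + 1) / 2
               - (real m - real n) * (real m - real n + 1) / 2)
             + (real m - real n) * (real m * real r - real \<alpha>) + 1) \<and>
        (m > n \<and> m > p \<longrightarrow>
           real (card (subsequence_sums \<alpha> A)) =
             real r * (real n * (real n + 1) / 2 + real p * (real p + 1) / 2
               - (real m - real n) * (real m - real n + 1) / 2
               - (real m - real p) * (real m - real p + 1) / 2)
             + (2 * real m - real n - real p) * (real m * real r - real \<alpha>) + 1))"

proof -
  let ?\<beta> = "r * k - \<alpha>"
  define total where
    "total = real (\<Sum>j=1..n. min (r * j) ?\<beta>) + real (\<Sum>j=1..p. min (r * j) ?\<beta>)"
  have "\<alpha> < r * k"
    using assms(1-3) by (cases "r * k") auto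
  have k: "n + p = k" "p + n = k" using assms(8) by auto
  have pos: "real (\<Sum>j=1..p. min (r * j) ?\<beta>) =
      (if m \<le> n then real r * (real p * (real p + 1) / 2)
       else real r * (real p * (real p + 1) / 2 - (real m - real n) * (real m - real n + 1) / 2)
         + (real m - real n) * (real m * real r - real \<alpha>))"
    by (rule sum_truncated_progression_split[OF k(1) assms(5-7)])
  have neg: "real (\<Sum>j=1..n. min (r * j) ?\<beta>) =
      (if m \<le> p then real r * (real n * (real n + 1) / 2)
       else real r * (real n * (real n + 1) / 2 - (real m - real p) * (real m - real p + 1) / 2)
         + (real m - real p) * (real m * real r - real \<alpha>))"
    by (rule sum_truncated_progression_split[OF k(2) assms(5-7)])
  have lower: "total + 1 \<le> real (card (subsequence_sums \<alpha> A))"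
    if "size A = r * k" "repeated_sequence r n p A" for A
    using card_subsequence_sums_gt[OF that(2), of \<alpha>] \<open>\<alpha> < r * k\<close> unfolding that(1) total_def
    by linarith
  have "r > 0" using assms(2) by simp
  let ?A = "interval_sequence r n p"
  have A: "size ?A = r * k" "repeated_sequence r n p ?A"
    using repeated_sequence_interval_sequence[OF \<open>r > 0\<close>] by (simp_all add: size_interval_sequence k)
  have "card (subsequence_sums \<alpha> ?A)
      \<le> (\<Sum>j=1..n. min (r * j) ?\<beta>) + (\<Sum>j=1..p. min (r * j) ?\<beta>) + 1"
    using card_subsequence_sums_interval_sequence_le[OF \<open>r > 0\<close>, of \<alpha> n p] by (simp add: k)
  then have extremal: "real (card (subsequence_sums \<alpha> ?A)) = total + 1"
    using lower[OF A] unfolding total_def by linarith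
  have closed_form: "m \<le> n \<Longrightarrow> m \<le> p \<Longrightarrow>
      total = real r * (real n * (real n + 1) / 2 + real p * (real p + 1) / 2)"
    "m \<le> n \<Longrightarrow> m > p \<Longrightarrow>
      total = real r * (real n * (real n + 1) / 2 + real p * (real p + 1) / 2
        - (real m - real p) * (real m - real p + 1) / 2)
      + (real m - real p) * (real m * real r - real \<alpha>)"
    "m > n \<Longrightarrow> m \<le> p \<Longrightarrow>
      total = real r * (real n * (real n + 1) / 2 + real p * (real p + 1) / 2
        - (real m - real n) * (real m - real n + 1) / 2)
      + (real m - real n) * (real m * real r - real \<alpha>)"
    "m > n \<Longrightarrow> m > p \<Longrightarrow>
      total = real r * (real n * (real n + 1) / 2 + real p * (real p + 1) / 2
        - (real m - real n) * (real m - real n + 1) / 2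
        - (real m - real p) * (real m - real p + 1) / 2)
      + (2 * real m - real n - real p) * (real m * real r - real \<alpha>)"
    unfolding total_def pos neg by (simp_all add: algebra_simps)
  show ?thesis
    by (intro conjI allI impI exI[of _ ?A] A; (elim conjE)?)
      (simp_all only: closed_form[symmetric] extremal lower)
qed

end
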